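(* Let $\mathbb{F}$ be $\mathbb{R}$ or $\mathbb{C}$, let $H$ be any Hilbert space over $\mathbb{F}$ (finite or infinite-dimensional), and let $n\ge 1$ be an integer with $\dim H \geq n$. Then $\operatorname{St}(n,H)$ has the homotopy type of the product $\operatorname{St}_{\operatorname{orth}}(n,H)\times \operatorname{P}_n(\mathbb{F})$; consequently, $\operatorname{St}(n,H)$ is homotopy equivalent to $\operatorname{St}_{\operatorname{orth}}(n,H)$.
   Context: $\operatorname{St}(n,H) = \{(v_1,\ldots,v_n)\in H^n : v_1,\ldots,v_n \text{ are linearly independent}\}$ and $\operatorname{St}_{\operatorname{orth}}(n,H) = \{(v_1,\ldots,v_n)\in H^n : \langle v_i,v_j\rangle = \delta_{ij} \text{ for all } i,j\}$, both with the subspace topology from the norm topology on $H^n$. $\operatorname{P}_n(\mathbb{F})$ is the set of positive definite self-adjoint $n\times n$ matrices with entries in $\mathbb{F}$, with the subspace topology from the space of $n\times n$ matrices. *)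

theory Defs
  imports "HOL-Analysis.Analysis"
begin

text \<open>
  A real Hilbert space is a type of sort \<open>{real_inner, complete_space}\<close>. The analogous class
  over the complex numbers is introduced here. The inner product is linear in its first argument.
  The axiom \<open>cinner_self\<close> says that the norm is the one induced by the inner product; positive
  definiteness follows from it.
\<close>

class complex_inner = real_normed_vector +
  fixes scaleC :: "complex \<Rightarrow> 'a \<Rightarrow> 'a"  (infixr \<open>*\<^sub>C\<close> 75)
    and cinner :: "'a \<Rightarrow> 'a \<Rightarrow> complex"
  assumes scaleC_add_right: "a *\<^sub>C (x + y) = a *\<^sub>C x + a *\<^sub>C y"
    and scaleC_add_left: "(a + b) *\<^sub>C x = a *\<^sub>C x + b *\<^sub>C x"
    and scaleC_scaleC: "a *\<^sub>C b *\<^sub>C x = (a * b) *\<^sub>C x"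
    and scaleC_of_real: "complex_of_real r *\<^sub>C x = scaleR r x"
    and cinner_commute: "cinner x y = cnj (cinner y x)"
    and cinner_add_left: "cinner (x + y) z = cinner x z + cinner y z"
    and cinner_scaleC_left: "cinner (a *\<^sub>C x) y = a * cinner x y"
    and cinner_self: "cinner x x = complex_of_real ((norm x)\<^sup>2)"

class complex_hilbert_space = complex_inner + complete_space

lemma vector_space_scaleC: "vector_space (scaleC :: complex \<Rightarrow> 'a::complex_inner \<Rightarrow> 'a)"
proof
  show "1 *\<^sub>C x = x" for x :: 'a
    using scaleC_of_real[of 1 x] by simp
qed (simp_all add: scaleC_add_right scaleC_add_left scaleC_scaleC)

text \<open>
  The notions below are parametrised by the scalar multiplication, the inner product, or the
  conjugation of the scalar field, as needed: \<open>scaleR\<close>, \<open>inner\<close>, \<open>\<lambda>x. x\<close> over the reals and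
  \<open>scaleC\<close>, \<open>cinner\<close>, \<open>cnj\<close> over the complex numbers. An \<open>n\<close>-tuple is an element of
  \<open>'h ^ 'n\<close> with \<open>n = CARD('n)\<close>, so that \<open>n \<ge> 1\<close>.
\<close>

text \<open>
  The library's \<open>dim\<close> is \<open>0\<close> on infinite-dimensional spaces, hence the explicit basis.
\<close>

definition dim_at_least :: "('f::field \<Rightarrow> 'h::ab_group_add \<Rightarrow> 'h) \<Rightarrow> nat \<Rightarrow> bool" where
  "dim_at_least smul n \<longleftrightarrow>
     (\<exists>B. \<not> module.dependent smul B \<and> module.span smul B = UNIV \<and> (infinite B \<or> n \<le> card B))"

definition St :: "('f::field \<Rightarrow> 'h::ab_group_add \<Rightarrow> 'h) \<Rightarrow> ('h ^ 'n::finite) set" where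
  "St smul = {v. \<forall>c. (\<Sum>i\<in>UNIV. smul (c i) (v $ i)) = 0 \<longrightarrow> (\<forall>i. c i = 0)}"

definition St_orth :: "('h \<Rightarrow> 'h \<Rightarrow> 'f::zero_neq_one) \<Rightarrow> ('h ^ 'n::finite) set" where
  "St_orth ip = {v. \<forall>i j. ip (v $ i) (v $ j) = (if i = j then 1 else 0)}"

text \<open>
  Positivity of \<open>x\<^sup>* A x\<close> is expressed by its being \<open>of_real\<close> of a positive real, as the complex
  numbers carry no order.
\<close>

definition Pos_def :: "('f \<Rightarrow> 'f::real_normed_field) \<Rightarrow> ('f ^ 'n ^ 'n::finite) set" where
  "Pos_def cj = {A. (\<forall>i j. A $ i $ j = cj (A $ j $ i)) \<and>
     (\<forall>x. x \<noteq> 0 \<longrightarrow> (\<exists>r>0. (\<Sum>i\<in>UNIV. cj (x $ i) * (A *v x) $ i) = of_real r))}"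

end

theory Submission
  imports Defs
begin

text \<open>
  The Gram-Schmidt process is performed one vector at a time. For a set \<open>S\<close> of indices and
  \<open>k \<notin> S\<close>, consider the independent tuples whose members with index in \<open>S\<close> are orthonormal.
  Replacing the \<open>k\<close>-th vector by its normalised component orthogonal to those members retracts
  this space onto the one for \<open>insert k S\<close>. The straight line between a tuple and its image only
  changes the \<open>k\<close>-th vector, in whose expansion the old \<open>k\<close>-th vector keeps a positive
  coefficient, so independence is preserved and the retraction is a deformation retraction.
  Going from \<open>S = {}\<close> to \<open>S = UNIV\<close> gives the second equivalence; the factor of positive
  definite matrices does not matter because it is convex.
\<close>

section \<open>Homotopy equivalences from straight-line homotopies\<close>

text \<open>The segment condition keeps the linear homotopy from \<open>r\<close> to the identity
  inside \<open>S\<close>, so the retraction \<open>r\<close> is a deformation retraction.\<close>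

lemma homotopy_eqv_straight_line_retract:
  fixes S T :: "'a::real_normed_vector set"
  assumes "T \<subseteq> S" and cont: "continuous_on S r" and rT: "\<And>x. x \<in> S \<Longrightarrow> r x \<in> T"
    and id: "\<And>x. x \<in> T \<Longrightarrow> r x = x"
    and seg: "\<And>x. x \<in> S \<Longrightarrow> closed_segment (r x) x \<subseteq> S"
  shows "S homotopy_eqv T"
proof (rule deformation_retract_imp_homotopy_equivalent_space)
  have "homotopic_with_canon (\<lambda>z. True) S S r (\<lambda>x. x)"
    by (rule homotopic_with_linear[OF cont continuous_on_id seg])
  then show "homotopic_with_canon (\<lambda>z. True) S S r id"
    by (simp add: id_def)
  show "retraction_maps (top_of_set S) (top_of_set T) r id"
    using assms by (auto simp: retraction_maps_def)
qed

text \<open>The second factor contracts linearly to \<open>a\<close> while the first coordinate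
  stays fixed.\<close>

lemma homotopy_eqv_Times_convex:
  fixes S :: "'a::real_normed_vector set" and C :: "'b::real_normed_vector set"
  assumes "convex C" and a: "a \<in> C"
  shows "S \<times> C homotopy_eqv S"
proof -
  have "S \<times> C homotopy_eqv S \<times> {a}"
  proof (rule homotopy_eqv_straight_line_retract)
    show "continuous_on (S \<times> C) (\<lambda>p. (fst p, a))"
      by (intro continuous_intros)
    show "closed_segment (fst p, a) p \<subseteq> S \<times> C" if p: "p \<in> S \<times> C" for p
    proof
      fix q assume "q \<in> closed_segment (fst p, a) p"
      then obtain u where u: "0 \<le> u" "u \<le> 1" "q = (1 - u) *\<^sub>R (fst p, a) + u *\<^sub>R p"
        by (auto simp: closed_segment_def)
      then have "fst q = fst p" "snd q = (1 - u) *\<^sub>R a + u *\<^sub>R snd p"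
        by (simp_all flip: scaleR_left_distrib)
      moreover have "(1 - u) *\<^sub>R a + u *\<^sub>R snd p \<in> C"
        using convexD_alt[OF assms(1) a, of "snd p" u] p u by auto
      ultimately show "q \<in> S \<times> C"
        using p by (metis mem_Times_iff)
    qed
  qed (use a in auto)
  also have "S \<times> {a} homotopy_eqv S"
  proof (rule homeomorphic_imp_homotopy_eqv)
    have "homeomorphism (S \<times> {a}) S fst (\<lambda>x. (x, a))"
      by (rule homeomorphismI) (auto intro!: continuous_intros)
    then show "S \<times> {a} homeomorphic S"
      by (auto simp: homeomorphic_def)
  qed
  finally show ?thesis .
qed

section \<open>Common setting for real and complex scalars\<close>

text \<open>Collects what the argument asks of either field, so that one proof serves both.
  Conjugation \<open>cj\<close> is only required to be real-linear with \<open>cj a * a\<close> the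
  squared norm, which covers the identity on the reals and \<open>cnj\<close>.\<close>

locale hilbert_scalars = vector_space smul
  for smul :: "'f::real_normed_field \<Rightarrow> 'h::real_normed_vector \<Rightarrow> 'h" +
  fixes ip :: "'h \<Rightarrow> 'h \<Rightarrow> 'f" and cj :: "'f \<Rightarrow> 'f"
  assumes smul_of_real: "smul (of_real r) x = r *\<^sub>R x"
    and ip_commute: "ip x y = cj (ip y x)"
    and ip_add_left: "ip (x + y) z = ip x z + ip y z"
    and ip_smul_left: "ip (smul a x) y = a * ip x y"
    and ip_self: "ip x x = of_real ((norm x)\<^sup>2)"
    and cj_add: "cj (a + b) = cj a + cj b"
    and cj_scaleR: "cj (r *\<^sub>R a) = r *\<^sub>R cj a"
    and cj_mult_self: "cj a * a = of_real ((norm a)\<^sup>2)"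
    and continuous_smul: "continuous_on UNIV (\<lambda>(a, x). smul a x)"
    and continuous_ip: "continuous_on UNIV (\<lambda>(x, y). ip x y)"
begin

lemma cj_0: "cj 0 = 0"
  using cj_add[of 0 0] by simp

lemma cj_1: "cj 1 = 1"
  using cj_mult_self[of 1] by simp

lemma ip_0_left: "ip 0 y = 0"
  using ip_smul_left[of 0 0 y] by simp

lemma ip_sum_left: "ip (\<Sum>i\<in>A. f i) y = (\<Sum>i\<in>A. ip (f i) y)"
  by (induction A rule: infinite_finite_induct) (simp_all add: ip_0_left ip_add_left)

lemma continuous_on_smul:
  assumes "continuous_on A f" "continuous_on A g"
  shows "continuous_on A (\<lambda>x. smul (f x) (g x))"
  using continuous_on_compose2[OF continuous_smul continuous_on_Pair[OF assms]] by simp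

lemma continuous_on_ip:
  assumes "continuous_on A f" "continuous_on A g"
  shows "continuous_on A (\<lambda>x. ip (f x) (g x))"
  using continuous_on_compose2[OF continuous_ip continuous_on_Pair[OF assms]] by simp

section \<open>Positive definite matrices\<close>

lemma Pos_defD_hermitian: "A \<in> Pos_def cj \<Longrightarrow> A $ i $ j = cj (A $ j $ i)"
  unfolding Pos_def_def by blast

lemma Pos_defD_pos:
  assumes "A \<in> Pos_def cj" "x \<noteq> 0"
  obtains r where "r > 0" "(\<Sum>i\<in>UNIV. cj (x $ i) * (A *v x) $ i) = of_real r"
  using assms unfolding Pos_def_def mem_Collect_eq by meson

text \<open>For fixed \<open>x\<close> the quadratic form is real-linear in the matrix, so a convex
  combination takes the value \<open>u * a + v * b\<close> with \<open>a\<close> and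
  \<open>b\<close> positive.\<close>

lemma convex_Pos_def: "convex (Pos_def cj :: ('f ^ 'n ^ 'n::finite) set)"
proof (rule convexI)
  fix A B :: "'f ^ 'n ^ 'n" and u v :: real
  assume A: "A \<in> Pos_def cj" and B: "B \<in> Pos_def cj" and uv: "0 \<le> u" "0 \<le> v" "u + v = 1"
  let ?M = "u *\<^sub>R A + v *\<^sub>R B"
  have "?M $ i $ j = cj (?M $ j $ i)" for i j
  proof -
    have "A $ i $ j = cj (A $ j $ i)" "B $ i $ j = cj (B $ j $ i)"
      using A B by (blast intro: Pos_defD_hermitian)+
    then show ?thesis
      by (simp only: vector_add_component vector_scaleR_component cj_add cj_scaleR)
  qed
  moreover have "\<exists>r>0. (\<Sum>i\<in>UNIV. cj (x $ i) * (?M *v x) $ i) = of_real r" if x: "x \<noteq> 0" for x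
  proof -
    obtain a b where a: "a > 0" "(\<Sum>i\<in>UNIV. cj (x $ i) * (A *v x) $ i) = of_real a"
      and b: "b > 0" "(\<Sum>i\<in>UNIV. cj (x $ i) * (B *v x) $ i) = of_real b"
      using Pos_defD_pos[OF A x] Pos_defD_pos[OF B x] by metis
    have "(?M *v x) $ i = u *\<^sub>R (A *v x) $ i + v *\<^sub>R (B *v x) $ i" for i
      by (simp add: matrix_vector_mult_def ring_distribs sum.distrib scaleR_sum_right)
    then have "(\<Sum>i\<in>UNIV. cj (x $ i) * (?M *v x) $ i) = u *\<^sub>R of_real a + v *\<^sub>R of_real b"
      unfolding a(2)[symmetric] b(2)[symmetric]
      by (simp add: distrib_left sum.distrib scaleR_sum_right)
    also have "\<dots> = of_real (u * a + v * b)"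
      by (simp add: scaleR_conv_of_real)
    finally have "(\<Sum>i\<in>UNIV. cj (x $ i) * (?M *v x) $ i) = of_real (u * a + v * b)" .
    \<comment> \<open>The weights cannot both vanish: \<open>u = 0\<close> forces
      \<open>v = 1\<close>.\<close>
    moreover have "u * a + v * b > 0"
      using a(1) b(1) uv by (cases "u = 0") (simp_all add: add_pos_nonneg)
    ultimately show ?thesis by blast
  qed
  ultimately show "?M \<in> Pos_def cj"
    unfolding Pos_def_def mem_Collect_eq by (intro conjI allI impI)
qed

lemma mat_1_in_Pos_def: "mat 1 \<in> (Pos_def cj :: ('f ^ 'n ^ 'n::finite) set)"
proof -
  have "\<exists>r>0. (\<Sum>i\<in>UNIV. cj (x $ i) * x $ i) = of_real r" if "x \<noteq> 0" for x :: "'f ^ 'n"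
  proof -
    obtain k where "x $ k \<noteq> 0"
      using \<open>x \<noteq> 0\<close> by (auto simp: vec_eq_iff)
    then have "(\<Sum>i\<in>UNIV. (norm (x $ i))\<^sup>2) > 0"
      by (intro sum_pos2[of _ k]) auto
    then show ?thesis
      by (intro exI[of _ "\<Sum>i\<in>UNIV. (norm (x $ i))\<^sup>2"]) (simp add: cj_mult_self)
  qed
  then show ?thesis
    by (simp add: Pos_def_def) (simp add: mat_def cj_0 cj_1)
qed

section \<open>Linear independence of tuples\<close>

text \<open>Pairing a vanishing combination with \<open>v $ j\<close> isolates the coefficient
  \<open>c j\<close>.\<close>

lemma St_orth_subset_St: "(St_orth ip :: ('h ^ 'n::finite) set) \<subseteq> St smul"
proof
  fix v :: "'h ^ 'n" assume v: "v \<in> St_orth ip"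
  have "c j = 0" if "(\<Sum>i\<in>UNIV. smul (c i) (v $ i)) = 0" for c j
  proof -
    have "ip (\<Sum>i\<in>UNIV. smul (c i) (v $ i)) (v $ j) = (\<Sum>i\<in>UNIV. if i = j then c i else 0)"
      using v unfolding ip_sum_left ip_smul_left by (intro sum.cong) (auto simp: St_orth_def)
    then show ?thesis
      using that by (simp add: ip_0_left)
  qed
  then show "v \<in> St smul"
    by (simp add: St_def)
qed

text \<open>The change of tuple is invertible because the old \<open>k\<close>-th vector enters the
  new one with nonzero coefficient.\<close>

lemma St_replace:
  fixes v :: "'h ^ 'n::finite"
  assumes v: "v \<in> St smul" and "b k \<noteq> 0"
  shows "(\<chi> j. if j = k then \<Sum>i\<in>UNIV. smul (b i) (v $ i) else v $ j) \<in> St smul"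
proof -
  have "\<forall>j. d j = 0"
    if d: "(\<Sum>j\<in>UNIV. smul (d j) (if j = k then \<Sum>i\<in>UNIV. smul (b i) (v $ i) else v $ j)) = 0" for d
  proof -
    \<comment> \<open>Coefficients with respect to \<open>v\<close> after expanding the new
      \<open>k\<close>-th vector. At \<open>k\<close> only \<open>d k * b k\<close> remains, which
      forces \<open>d k = 0\<close>; then \<open>e\<close> agrees with \<open>d\<close>
      elsewhere.\<close>
    define e where "e j = d k * b j + (if j = k then 0 else d j)" for j
    have "smul (d j) (if j = k then \<Sum>i\<in>UNIV. smul (b i) (v $ i) else v $ j)
        = (if j = k then smul (d k) (\<Sum>i\<in>UNIV. smul (b i) (v $ i)) else 0)
          + smul (if j = k then 0 else d j) (v $ j)" for j
      by simp
    then have "(\<Sum>i\<in>UNIV. smul (e i) (v $ i)) = 0"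
      using d by (simp add: e_def scale_left_distrib sum.distrib scale_sum_right)
    then have e: "e j = 0" for j
      using v by (simp add: St_def)
    then have "d k = 0"
      using e[of k] \<open>b k \<noteq> 0\<close> by (simp add: e_def)
    then show ?thesis
      using e by (metis add_0 e_def mult_zero_left)
  qed
  then show ?thesis
    by (simp add: St_def)
qed

section \<open>One Gram-Schmidt step\<close>

text \<open>When the members indexed by \<open>S\<close> are orthonormal and \<open>k\<close> is
  outside \<open>S\<close>, these are the coefficients of \<open>v $ k\<close> minus its orthogonal
  projection onto their span. They are indexed by all of \<open>'n\<close> to fit the form of
  \<open>St_replace\<close>.\<close>

definition resid_coeff :: "'n set \<Rightarrow> 'n \<Rightarrow> 'h ^ 'n \<Rightarrow> 'n \<Rightarrow> 'f" where
  "resid_coeff S k v i = (if i = k then 1 else if i \<in> S then - ip (v $ k) (v $ i) else 0)"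

definition resid :: "'n set \<Rightarrow> 'n \<Rightarrow> 'h ^ 'n \<Rightarrow> 'h" where
  "resid S k v = (\<Sum>i\<in>UNIV. smul (resid_coeff S k v i) (v $ i))"

definition orth_step :: "'n set \<Rightarrow> 'n \<Rightarrow> 'h ^ 'n \<Rightarrow> 'h ^ 'n" where
  "orth_step S k v = (\<chi> j. if j = k then (1 / norm (resid S k v)) *\<^sub>R resid S k v else v $ j)"

definition St_partial :: "'n::finite set \<Rightarrow> ('h ^ 'n) set" where
  "St_partial S =
     {v \<in> St smul. \<forall>i\<in>S. \<forall>j\<in>S. ip (v $ i) (v $ j) = (if i = j then 1 else 0)}"

text \<open>The residual has coefficient 1 at \<open>k\<close>, so its vanishing would contradict
  independence.\<close>

lemma resid_nonzero:
  fixes v :: "'h ^ 'n::finite"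
  assumes "v \<in> St smul"
  shows "resid S k v \<noteq> 0"
proof
  assume "resid S k v = 0"
  then have "resid_coeff S k v k = 0"
    using assms unfolding resid_def St_def by blast
  then show False
    by (simp add: resid_coeff_def)
qed

lemma ip_resid:
  fixes v :: "'h ^ 'n::finite"
  assumes v: "v \<in> St_partial S" and "k \<notin> S" "j \<in> S"
  shows "ip (resid S k v) (v $ j) = 0"
proof -
  have "ip (resid S k v) (v $ j) = (\<Sum>i\<in>UNIV. resid_coeff S k v i * ip (v $ i) (v $ j))"
    by (simp add: resid_def ip_sum_left ip_smul_left)
  \<comment> \<open>By orthonormality on \<open>S\<close>, only the terms at \<open>k\<close> and at
    \<open>j\<close> survive, and they cancel.\<close>
  also have "\<dots> = (\<Sum>i\<in>UNIV. (if i = k then ip (v $ k) (v $ j) else 0)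
                       - (if i = j then ip (v $ k) (v $ j) else 0))"
    using assms by (intro sum.cong) (auto simp: resid_coeff_def St_partial_def)
  also have "\<dots> = 0"
    by (simp add: sum_subtractf)
  finally show ?thesis .
qed

lemma segment_orth_step:
  fixes v :: "'h ^ 'n::finite"
  assumes v: "v \<in> St_partial S" and "k \<notin> S"
  shows "closed_segment (orth_step S k v) v \<subseteq> St_partial S"
proof
  fix w assume "w \<in> closed_segment (orth_step S k v) v"
  then obtain u where u: "0 \<le> u" "u \<le> 1" "w = (1 - u) *\<^sub>R orth_step S k v + u *\<^sub>R v"
    by (auto simp: closed_segment_def)
  have vS: "v \<in> St smul"
    using v by (simp add: St_partial_def)
  define m where "m = 1 / norm (resid S k v)"
  have "m > 0"
    using resid_nonzero[OF vS] by (simp add: m_def)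
  \<comment> \<open>Coefficients of \<open>w $ k\<close> in the tuple \<open>v\<close>: the
    normalised residual weighted by \<open>1 - u\<close>, plus \<open>u\<close> times the old
    vector. At \<open>k\<close> this is \<open>(1 - u) * m + u\<close>, which is positive.\<close>
  define b where
    "b i = of_real ((1 - u) * m) * resid_coeff S k v i + (if i = k then of_real u else 0)" for i
  have "(\<Sum>i\<in>UNIV. smul (b i) (v $ i))
      = (\<Sum>i\<in>UNIV. smul (of_real ((1 - u) * m)) (smul (resid_coeff S k v i) (v $ i))
                     + (if i = k then smul (of_real u) (v $ k) else 0))"
    by (intro sum.cong) (auto simp: b_def scale_left_distrib)
  also have "\<dots> = ((1 - u) * m) *\<^sub>R resid S k v + u *\<^sub>R v $ k"
    by (simp only: sum.distrib resid_def smul_of_real scaleR_sum_right) simp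
  finally have "w $ k = (\<Sum>i\<in>UNIV. smul (b i) (v $ i))"
    by (simp add: u orth_step_def m_def)
  moreover have w: "w $ j = v $ j" if "j \<noteq> k" for j
    using that by (simp add: u orth_step_def flip: scaleR_left_distrib)
  ultimately have "w = (\<chi> j. if j = k then \<Sum>i\<in>UNIV. smul (b i) (v $ i) else v $ j)"
    by (simp add: vec_eq_iff)
  moreover have "b k \<noteq> 0"
  proof -
    have "(1 - u) * m + u > 0"
      using u \<open>m > 0\<close> by (cases "u = 0") (auto intro: add_nonneg_pos)
    then have "of_real ((1 - u) * m + u) \<noteq> (0 :: 'f)"
      by (metis of_real_eq_0_iff less_irrefl)
    then show ?thesis
      by (simp add: b_def resid_coeff_def)
  qed
  ultimately have "w \<in> St smul"
    using St_replace[OF vS] by metis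
  moreover have "w $ i = v $ i" if "i \<in> S" for i
    using w that \<open>k \<notin> S\<close> by metis
  ultimately show "w \<in> St_partial S"
    using v by (simp add: St_partial_def)
qed

lemma orth_step_in:
  fixes v :: "'h ^ 'n::finite"
  assumes v: "v \<in> St_partial S" and k: "k \<notin> S"
  shows "orth_step S k v \<in> St_partial (insert k S)"
proof -
  let ?w = "orth_step S k v" and ?m = "1 / norm (resid S k v)"
  have wk: "?w $ k = smul (of_real ?m) (resid S k v)"
    unfolding smul_of_real by (simp add: orth_step_def)
  have wS: "?w $ i = v $ i" if "i \<in> S" for i
    using that k by (auto simp: orth_step_def)
  \<comment> \<open>The image is an endpoint of the segment.\<close>
  have w: "?w \<in> St_partial S"
    using segment_orth_step[OF assms] by auto
  have "norm (?w $ k) = 1"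
    using v resid_nonzero[of v S k] by (simp add: orth_step_def St_partial_def)
  then have "ip (?w $ k) (?w $ k) = 1"
    by (simp add: ip_self)
  moreover have left: "ip (?w $ k) (?w $ j) = 0" if "j \<in> S" for j
    using ip_resid[OF v k that] that by (simp add: wk wS ip_smul_left)
  moreover have "ip (?w $ j) (?w $ k) = 0" if "j \<in> S" for j
    using left[OF that] ip_commute[of "?w $ j" "?w $ k"] by (simp add: cj_0)
  ultimately show ?thesis
    using w k by (auto simp: St_partial_def)
qed

text \<open>If \<open>v $ k\<close> is already a unit vector orthogonal to the others indexed by
  \<open>S\<close>, nothing is subtracted and the normalising factor is 1.\<close>

lemma orth_step_eq_self:
  fixes v :: "'h ^ 'n::finite"
  assumes v: "v \<in> St_partial (insert k S)"
  shows "orth_step S k v = v"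
proof -
  have "resid_coeff S k v i = (if i = k then 1 else 0)" for i
    using v by (auto simp: resid_coeff_def St_partial_def)
  then have "resid S k v = (\<Sum>i\<in>UNIV. if i = k then v $ k else 0)"
    unfolding resid_def by (intro sum.cong) auto
  then have r: "resid S k v = v $ k"
    by simp
  have "ip (v $ k) (v $ k) = 1"
    using v by (simp add: St_partial_def)
  then have "(norm (v $ k))\<^sup>2 = 1"
    by (metis ip_self of_real_eq_1_iff)
  then have "norm (v $ k) = 1"
    by (simp add: power2_eq_1_iff) (use norm_ge_zero[of "v $ k"] in linarith)
  then show ?thesis
    by (simp add: orth_step_def r vec_eq_iff)
qed

text \<open>Independence keeps the norm in the denominator away from zero at every point of the
  domain.\<close>

lemma continuous_on_orth_step:
  "continuous_on (St smul) (orth_step S k :: 'h ^ 'n::finite \<Rightarrow> 'h ^ 'n)"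
proof -
  have "continuous_on (St smul) (\<lambda>v::'h ^ 'n. resid_coeff S k v i)" for i
    unfolding resid_coeff_def
    by (cases "i = k"; cases "i \<in> S")
       (auto intro!: continuous_intros continuous_on_ip)
  then have r: "continuous_on (St smul) (\<lambda>v::'h ^ 'n. resid S k v)"
    unfolding resid_def by (intro continuous_intros continuous_on_smul)
  have "continuous_on (St smul)
     (\<lambda>v::'h ^ 'n. if j = k then (1 / norm (resid S k v)) *\<^sub>R resid S k v else v $ j)" for j
    by (cases "j = k") (auto intro!: continuous_intros r simp: resid_nonzero)
  then show ?thesis
    unfolding orth_step_def by (intro continuous_on_vec_lambda)
qed

section \<open>Iterating the steps over all indices\<close>

lemma St_partial_homotopy_eqv_insert:
  fixes S :: "'n::finite set"
  assumes "k \<notin> S"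
  shows "St_partial S homotopy_eqv St_partial (insert k S)"
proof (rule homotopy_eqv_straight_line_retract)
  show "continuous_on (St_partial S) (orth_step S k)"
    by (rule continuous_on_subset[OF continuous_on_orth_step]) (auto simp: St_partial_def)
  show "St_partial (insert k S) \<subseteq> St_partial S"
    by (auto simp: St_partial_def)
qed (use assms in \<open>simp_all add: orth_step_in orth_step_eq_self segment_orth_step\<close>)

lemma St_homotopy_eqv_St_orth:
  "(St smul :: ('h ^ 'n::finite) set) homotopy_eqv (St_orth ip :: ('h ^ 'n) set)"
proof -
  have "(St smul :: ('h ^ 'n) set) homotopy_eqv (St_partial S :: ('h ^ 'n) set)" for S
  proof (induction S rule: finite_induct[OF finite])
    case 1
    show ?case
      by (simp add: St_partial_def homotopy_equivalent_space_refl)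
  next
    case (2 k S)
    then show ?case
      using homotopy_eqv_trans St_partial_homotopy_eqv_insert by blast
  qed
  \<comment> \<open>Orthonormality of all members already implies independence.\<close>
  moreover have "(St_partial UNIV :: ('h ^ 'n) set) = St_orth ip"
    using St_orth_subset_St by (auto simp: St_partial_def St_orth_def)
  ultimately show ?thesis
    by metis
qed

lemma St_homotopy_eqv_product:
  "(St smul :: ('h ^ 'n::finite) set) homotopy_eqv
     ((St_orth ip :: ('h ^ 'n) set) \<times> (Pos_def cj :: ('f ^ 'n ^ 'n) set))"
  using homotopy_eqv_trans[OF St_homotopy_eqv_St_orth]
    homotopy_eqv_Times_convex[OF convex_Pos_def mat_1_in_Pos_def]
    homotopy_equivalent_space_sym by blast

end

section \<open>The real and complex instances\<close>

lemma hilbert_scalars_real: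
  "hilbert_scalars (scaleR :: real \<Rightarrow> 'r::real_inner \<Rightarrow> 'r) inner (\<lambda>x. x)"
proof unfold_locales
  show "continuous_on UNIV (\<lambda>(a, x). a *\<^sub>R x :: 'r)"
    unfolding case_prod_unfold by (intro continuous_intros)
  show "continuous_on UNIV (\<lambda>(x::'r, y). inner x y)"
    unfolding case_prod_unfold by (intro continuous_intros)
qed (auto simp: algebra_simps inner_commute inner_add_left dot_square_norm power2_eq_square)

text \<open>Polarisation: the real part is expressed through norms alone, which makes its continuity
  available.\<close>

lemma cinner_Re: "Re (cinner x y) = ((norm (x + y))\<^sup>2 - (norm x)\<^sup>2 - (norm y)\<^sup>2) / 2"
proof -
  have add_right: "cinner z (x + y) = cinner z x + cinner z y" for z
    by (metis cinner_commute cinner_add_left complex_cnj_add)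
  have self: "Re (cinner z z) = (norm z)\<^sup>2" for z :: 'a
    by (simp add: cinner_self)
  have "Re (cinner y x) = Re (cinner x y)"
    by (metis cinner_commute cnj.sel(1))
  then have "Re (cinner (x + y) (x + y)) = (norm x)\<^sup>2 + 2 * Re (cinner x y) + (norm y)\<^sup>2"
    by (simp add: cinner_add_left add_right self)
  then show ?thesis
    by (simp add: self)
qed

lemma cinner_Im: "Im (cinner x y) = - Re (cinner (\<i> *\<^sub>C x) y)"
  by (simp add: cinner_scaleC_left)

text \<open>Follows from \<open>\<i> * cnj \<i> = 1\<close>, since \<open>cinner x x\<close> is
  real. It makes multiplication by \<open>\<i>\<close> bounded, hence continuous.\<close>

lemma norm_ii_scaleC: "norm (\<i> *\<^sub>C x) = norm x" for x :: "'a::complex_inner"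
proof -
  have "cinner (\<i> *\<^sub>C x) (\<i> *\<^sub>C x) = \<i> * cnj (\<i> * cinner x x)"
    by (metis cinner_scaleC_left cinner_commute)
  also have "\<dots> = cinner x x"
    by (simp add: cinner_self)
  finally have "(norm (\<i> *\<^sub>C x))\<^sup>2 = (norm x)\<^sup>2"
    by (simp add: cinner_self flip: of_real_power)
  then show ?thesis
    by simp
qed

lemma bounded_linear_ii_scaleC: "bounded_linear (\<lambda>x::'a::complex_inner. \<i> *\<^sub>C x)"
proof (rule bounded_linear_intro[where K = 1])
  show "\<i> *\<^sub>C r *\<^sub>R x = r *\<^sub>R \<i> *\<^sub>C x" for r and x :: 'a
    by (simp add: scaleC_scaleC mult.commute flip: scaleC_of_real)
qed (simp_all add: scaleC_add_right norm_ii_scaleC)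

text \<open>Reduces joint continuity of \<open>scaleC\<close> to that of real scaling and of
  multiplication by \<open>\<i>\<close>.\<close>

lemma scaleC_conv_scaleR: "c *\<^sub>C x = Re c *\<^sub>R x + Im c *\<^sub>R \<i> *\<^sub>C x"
proof -
  have "c *\<^sub>C x = (complex_of_real (Re c) + complex_of_real (Im c) * \<i>) *\<^sub>C x"
    by (simp add: mult.commute flip: complex_eq)
  then show ?thesis
    by (simp only: scaleC_add_left scaleC_of_real flip: scaleC_scaleC)
qed

lemma hilbert_scalars_complex:
  "hilbert_scalars (scaleC :: complex \<Rightarrow> 'c::complex_inner \<Rightarrow> 'c) cinner cnj"
proof -
  interpret vector_space "scaleC :: complex \<Rightarrow> 'c \<Rightarrow> 'c"
    by (rule vector_space_scaleC)
  note ii = bounded_linear.continuous_on[OF bounded_linear_ii_scaleC]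
  show ?thesis
  proof unfold_locales
    show "continuous_on UNIV (\<lambda>(a, x). a *\<^sub>C x :: 'c)"
      unfolding case_prod_unfold scaleC_conv_scaleR[of "fst _"]
      by (intro continuous_intros ii)
    \<comment> \<open>The general \<open>f\<close> serves twice: as \<open>fst\<close> for the real
      part and as \<open>\<i>\<close> times \<open>fst\<close> for the imaginary part via
      \<open>cinner_Im\<close>.\<close>
    have Re: "continuous_on UNIV (\<lambda>p::'c \<times> 'c. Re (cinner (f p) (snd p)))"
      if "continuous_on UNIV f" for f
      unfolding cinner_Re by (intro continuous_intros that) simp
    have "continuous_on UNIV (\<lambda>p::'c \<times> 'c. Complex (Re (cinner (fst p) (snd p)))
                                                      (- Re (cinner (\<i> *\<^sub>C fst p) (snd p))))"
      unfolding Complex_eq by (intro continuous_intros Re ii)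
    then show "continuous_on UNIV (\<lambda>(x::'c, y). cinner x y)"
      by (simp add: case_prod_unfold flip: cinner_Im)
    show "cinner x y = cnj (cinner y x)" for x y :: 'c
      by (rule cinner_commute)
    show "cnj a * a = complex_of_real ((norm a)\<^sup>2)" for a
      by (metis complex_norm_square mult.commute)
  qed (simp_all add: scaleC_of_real cinner_add_left cinner_scaleC_left cinner_self)
qed

theorem corollary3p3:
  shows
    "(dim_at_least (scaleR :: real \<Rightarrow> 'r::{real_inner, complete_space} \<Rightarrow> 'r) CARD('n::finite) \<longrightarrow>
       (St scaleR :: ('r ^ 'n) set) homotopy_eqv
         ((St_orth inner :: ('r ^ 'n) set) \<times> (Pos_def (\<lambda>x. x) :: (real ^ 'n ^ 'n) set)) \<and>
       (St scaleR :: ('r ^ 'n) set) homotopy_eqv (St_orth inner :: ('r ^ 'n) set)) \<and>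
     (dim_at_least (scaleC :: complex \<Rightarrow> 'c::complex_hilbert_space \<Rightarrow> 'c) CARD('n) \<longrightarrow>
       (St scaleC :: ('c ^ 'n) set) homotopy_eqv
         ((St_orth cinner :: ('c ^ 'n) set) \<times> (Pos_def cnj :: (complex ^ 'n ^ 'n) set)) \<and>
       (St scaleC :: ('c ^ 'n) set) homotopy_eqv (St_orth cinner :: ('c ^ 'n) set))"
  by (intro conjI impI
      hilbert_scalars.St_homotopy_eqv_product[OF hilbert_scalars_real]
      hilbert_scalars.St_homotopy_eqv_St_orth[OF hilbert_scalars_real]
      hilbert_scalars.St_homotopy_eqv_product[OF hilbert_scalars_complex]
      hilbert_scalars.St_homotopy_eqv_St_orth[OF hilbert_scalars_complex])

end
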